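(* For every $n\ge1$, $R_n(124/3)$ is the set of all restricted growth functions $w$ of length $n$ such that every letter occurring in $w$ is either a block letter or a singleton-block letter of $w$.
   Context: A set partition $\sigma$ of $[n]=\{1,\dots,n\}$ is written $\sigma=B_1/B_2/\dots/B_m$ with blocks ordered so that $\min B_1<\dots<\min B_m$. For $A\subseteq[n]$, the subpartition $A\cap\sigma$ is the set partition of $A$ formed by the nonempty sets $A\cap B_i$; it is standardized by replacing its smallest element by $1$, the next smallest by $2$, and so on. $\sigma$ contains a pattern $\pi$ (a set partition of some $[k]$) if some subpartition of $\sigma$ standardizes to $\pi$; otherwise $\sigma$ avoids $\pi$. $\Pi_n(\pi)$ is the set of set partitions of $[n]$ avoiding $\pi$. A restricted growth function (RGF) of length $n$ is a word $w=w_1\cdots w_n$ of positive integers with $w_1=1$ and $w_i\le 1+\max\{w_1,\dots,w_{i-1}\}$ for $i\ge2$. To $\sigma=B_1/\dots/B_m$ corresponds the RGF $w(\sigma)$ with $w_i=j$ if $i\in B_j$. $R_n(\pi)=\{w(\sigma):\sigma\in\Pi_n(\pi)\}$. The pattern $124/3$ is the set partition $\{1,2,4\},\{3\}$ of $[4]$. A block of $a$s in $w$ is a maximal run of consecutive letters equal to $a$. A letter $a$ of $w$ is a block letter if all its occurrences in $w$ form a single block (of one or more $a$s). A letter $b$ is a singleton-block letter if its first occurrence is immediately followed by a letter different from $b$, and all other occurrences of $b$ in $w$ form a single (nonempty) block after this. *)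

theory Defs
  imports "HOL-Library.Disjoint_Sets"
begin

definition subpartition :: "nat set \<Rightarrow> nat set set \<Rightarrow> nat set set" where
  "subpartition A \<sigma> = (\<lambda>B. A \<inter> B) ` \<sigma> - {{}}"

text \<open>The smallest element of \<^term>\<open>A\<close> has rank 1, the next smallest has rank 2, and so on.\<close>

definition rank :: "nat set \<Rightarrow> nat \<Rightarrow> nat" where
  "rank A x = card {y \<in> A. y \<le> x}"

definition standardize :: "nat set set \<Rightarrow> nat set set" where
  "standardize \<tau> = (\<lambda>B. rank (\<Union>\<tau>) ` B) ` \<tau>"

definition contains_pattern :: "nat set set \<Rightarrow> nat set set \<Rightarrow> bool" where
  "contains_pattern \<sigma> \<pi> \<longleftrightarrow> (\<exists>A \<subseteq> \<Union>\<sigma>. standardize (subpartition A \<sigma>) = \<pi>)"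

definition avoiding_partitions :: "nat \<Rightarrow> nat set set \<Rightarrow> nat set set set" where
  "avoiding_partitions n \<pi> = {\<sigma>. partition_on {1..n} \<sigma> \<and> \<not> contains_pattern \<sigma> \<pi>}"

text \<open>Words are lists of naturals; the letter $w_i$ of a word is the list entry \<open>w ! (i - 1)\<close>.\<close>

definition restricted_growth_function :: "nat list \<Rightarrow> bool" where
  "restricted_growth_function w \<longleftrightarrow>
     w \<noteq> [] \<and> (\<forall>a \<in> set w. 0 < a) \<and> w ! 0 = 1 \<and>
     (\<forall>i. 0 < i \<and> i < length w \<longrightarrow> w ! i \<le> 1 + Max (set (take i w)))"

text \<open>The blocks $B_1, \dots, B_m$ of a set partition, listed so that
  $\min B_1 < \dots < \min B_m$.\<close>

definition ordered_blocks :: "nat set set \<Rightarrow> nat set list" where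
  "ordered_blocks \<sigma> = sorted_key_list_of_set Min \<sigma>"

lemma (in linorder) sorted_key_list_of_set_inj:
  assumes "inj_on f S" "finite S"
  shows "set (sorted_key_list_of_set f S) = S"
    and "sorted_wrt (<) (map f (sorted_key_list_of_set f S))"
proof -
  interpret folding_insort_key "(\<le>)" "(<)" S f
    by unfold_locales (rule assms)
  show "set (sorted_key_list_of_set f S) = S"
    using assms by simp
  show "sorted_wrt (<) (map f (sorted_key_list_of_set f S))"
    by (rule strict_sorted_key_list_of_set) simp
qed

lemma ordered_blocks:
  assumes "partition_on {1..n} \<sigma>"
  shows "set (ordered_blocks \<sigma>) = \<sigma>"
    and "sorted_wrt (\<lambda>B C. Min B < Min C) (ordered_blocks \<sigma>)"
proof -
  have fin: "finite \<sigma>"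
    using assms finite_elements by blast
  have inj: "inj_on Min \<sigma>"
  proof (rule inj_onI)
    fix B C assume BC: "B \<in> \<sigma>" "C \<in> \<sigma>" "Min B = Min C"
    have "B \<subseteq> {1..n}" "C \<subseteq> {1..n}" "B \<noteq> {}" "C \<noteq> {}"
      using assms BC unfolding partition_on_def by blast+
    then have "finite B" "finite C" "B \<noteq> {}" "C \<noteq> {}"
      using finite_subset by blast+
    then have "Min B \<in> B" "Min C \<in> C" by auto
    then show "B = C"
      using assms BC by (metis disjointD disjoint_iff partition_onD2)
  qed
  show "set (ordered_blocks \<sigma>) = \<sigma>"
    using sorted_key_list_of_set_inj(1)[OF inj fin] by (simp add: ordered_blocks_def)
  show "sorted_wrt (\<lambda>B C. Min B < Min C) (ordered_blocks \<sigma>)"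
    using sorted_key_list_of_set_inj(2)[OF inj fin] by (simp add: ordered_blocks_def sorted_wrt_map)
qed

definition rgf_of_partition :: "nat \<Rightarrow> nat set set \<Rightarrow> nat list" where
  "rgf_of_partition n \<sigma> =
     map (\<lambda>i. THE j. 1 \<le> j \<and> j \<le> length (ordered_blocks \<sigma>) \<and> i \<in> ordered_blocks \<sigma> ! (j - 1))
       [1..<Suc n]"

definition R :: "nat \<Rightarrow> nat set set \<Rightarrow> nat list set" where
  "R n \<pi> = rgf_of_partition n ` avoiding_partitions n \<pi>"

definition occurrences :: "nat list \<Rightarrow> nat \<Rightarrow> nat set" where
  "occurrences w a = {i. i < length w \<and> w ! i = a}"

text \<open>The positions \<open>i, \<dots>, j - 1\<close> carry a maximal run of \<open>a\<close>s.\<close>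

definition is_block :: "nat list \<Rightarrow> nat \<Rightarrow> nat \<Rightarrow> nat \<Rightarrow> bool" where
  "is_block w a i j \<longleftrightarrow>
     i < j \<and> j \<le> length w \<and> (\<forall>k \<in> {i..<j}. w ! k = a) \<and>
     (i = 0 \<or> w ! (i - 1) \<noteq> a) \<and> (j = length w \<or> w ! j \<noteq> a)"

definition block_letter :: "nat list \<Rightarrow> nat \<Rightarrow> bool" where
  "block_letter w a \<longleftrightarrow> (\<exists>i j. is_block w a i j \<and> occurrences w a = {i..<j})"

definition singleton_block_letter :: "nat list \<Rightarrow> nat \<Rightarrow> bool" where
  "singleton_block_letter w b \<longleftrightarrow>
     (\<exists>p i j. p \<in> occurrences w b \<and> (\<forall>q \<in> occurrences w b. p \<le> q) \<and>
        Suc p < length w \<and> w ! Suc p \<noteq> b \<and>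
        p < i \<and> is_block w b i j \<and> occurrences w b - {p} = {i..<j})"

end

theory Submission
  imports Defs
begin

text \<open>A set partition contains 124/3 exactly when its word has a letter \<open>a\<close> and positions
  $p < q < r < s$ carrying \<open>a\<close>, \<open>a\<close>, a different letter, and \<open>a\<close>. Avoiding this means that the
  occurrences of each letter other than the first one form an interval; the letter is then a block
  letter or a singleton-block letter, according to whether the first occurrence is adjacent to
  that interval.\<close>

section \<open>Containment of 124/3\<close>

lemma Union_subpartition: "A \<subseteq> \<Union>\<sigma> \<Longrightarrow> \<Union>(subpartition A \<sigma>) = A"
  unfolding subpartition_def by blast

text \<open>Ranks are monotone in the element, so this is a contrapositive. It carries the order of
  the ranks 1, 2, 3, 4 back to the elements that have them.\<close>

lemma rank_less_imp_less:
  assumes "finite A" "rank A x < rank A y"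
  shows "x < y"
proof (rule ccontr)
  assume "\<not> x < y"
  then have "{z \<in> A. z \<le> y} \<subseteq> {z \<in> A. z \<le> x}" by auto
  then have "rank A y \<le> rank A x"
    unfolding rank_def using assms(1) by (intro card_mono) auto
  with assms(2) show False by simp
qed

text \<open>The witnesses are the elements of \<open>A\<close> of ranks 1, 2, 3, 4: those of ranks
  1, 2, 4 lie in the trace of one block, and the one of rank 3 lies in another trace.\<close>

lemma contains_124_3_imp:
  assumes "partition_on {1..n} \<sigma>" "contains_pattern \<sigma> {{1, 2, 4}, {3}}"
  shows "\<exists>B\<in>\<sigma>. \<exists>a b c d. a < b \<and> b < c \<and> c < d \<and> a \<in> B \<and> b \<in> B \<and> d \<in> B \<and>
    c \<in> {1..n} - B"
proof -
  obtain A where A: "A \<subseteq> \<Union>\<sigma>" and st: "standardize (subpartition A \<sigma>) = {{1, 2, 4}, {3}}"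
    using assms(2) unfolding contains_pattern_def by blast
  have An: "A \<subseteq> {1..n}"
    using A assms(1) by (simp add: partition_on_def)
  then have fin: "finite A"
    using finite_subset by blast
  have img: "(\<lambda>B. rank A ` B) ` subpartition A \<sigma> = {{1, 2, 4}, {3}}"
    using st unfolding standardize_def Union_subpartition[OF A] .
  have "{1, 2, 4} \<in> (\<lambda>B. rank A ` B) ` subpartition A \<sigma>"
    "{3} \<in> (\<lambda>B. rank A ` B) ` subpartition A \<sigma>"
    unfolding img by simp_all
  then obtain B' C' where B': "B' \<in> subpartition A \<sigma>" "rank A ` B' = {1, 2, 4}"
    and C': "C' \<in> subpartition A \<sigma>" "rank A ` C' = {3}"
    by (elim imageE) (rule that, simp_all)
  obtain B where B: "B \<in> \<sigma>" "B' = A \<inter> B"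
    using B'(1) unfolding subpartition_def by blast
  have "1 \<in> rank A ` B'" "2 \<in> rank A ` B'" "4 \<in> rank A ` B'" "3 \<in> rank A ` C'"
    using B'(2) C'(2) by simp_all
  then obtain a b c d where abcd: "a \<in> B'" "b \<in> B'" "d \<in> B'" "c \<in> C'"
      "rank A a = 1" "rank A b = 2" "rank A c = 3" "rank A d = 4"
    unfolding image_iff by metis
  have "c \<in> A"
    using abcd(4) C'(1) unfolding subpartition_def by blast
  \<comment> \<open>Since \<open>c \<in> A\<close> and \<open>B' = A \<inter> B\<close>, this
    excludes \<open>c\<close> from all of \<open>B\<close>.\<close>
  moreover have "c \<notin> B'"
  proof
    assume "c \<in> B'"
    then have "rank A c \<in> {1, 2, 4}" using B'(2) by blast
    with abcd(7) show False by simp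
  qed
  moreover have "a < b" "b < c" "c < d"
    using abcd(5-8) by (simp_all add: rank_less_imp_less[OF fin])
  ultimately show ?thesis
    using B abcd(1-3) An by blast
qed

text \<open>Take \<open>A = {a, b, c, d}\<close>. Only \<open>B\<close> and the block of
  \<open>c\<close> meet it, and the ranks of \<open>a\<close>, \<open>b\<close>, \<open>c\<close>,
  \<open>d\<close> in it are 1, 2, 3, 4.\<close>

lemma contains_124_3I:
  assumes part: "partition_on {1..n} \<sigma>" and B: "B \<in> \<sigma>"
    and less: "a < b" "b < c" "c < d"
    and mem: "a \<in> B" "b \<in> B" "d \<in> B" "c \<in> {1..n} - B"
  shows "contains_pattern \<sigma> {{1, 2, 4}, {3}}"
proof -
  let ?A = "{a, b, c, d}"
  obtain C where C: "C \<in> \<sigma>" "c \<in> C"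
    using mem(4) partition_onD1[OF part] by blast
  have dis: "X = Y" if "X \<in> \<sigma>" "Y \<in> \<sigma>" "x \<in> X" "x \<in> Y" for X Y x
    using partition_onD2[OF part] that by (auto simp: disjoint_def)
  have AB: "?A \<inter> B = {a, b, d}" using mem by auto
  have AC: "?A \<inter> C = {c}"
    using C mem dis[OF B C(1)] by auto
  \<comment> \<open>All remaining traces are empty, and \<open>subpartition\<close> discards
    them.\<close>
  have other: "?A \<inter> X = {}" if "X \<in> \<sigma>" "X \<noteq> B" "X \<noteq> C" for X
    using that mem C dis[OF B that(1)] dis[OF C(1) that(1)] by auto
  have sub: "subpartition ?A \<sigma> = {{a, b, d}, {c}}"
  proof (intro equalityI subsetI)
    fix Y assume "Y \<in> subpartition ?A \<sigma>"
    then obtain X where "X \<in> \<sigma>" "Y = ?A \<inter> X" "Y \<noteq> {}"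
      unfolding subpartition_def by blast
    then show "Y \<in> {{a, b, d}, {c}}"
      using other[of X] AB AC by (cases "X = B"; cases "X = C") auto
  next
    fix Y assume "Y \<in> {{a, b, d}, {c}}"
    then have "Y = ?A \<inter> B \<or> Y = ?A \<inter> C" "Y \<noteq> {}"
      unfolding AB AC by auto
    then show "Y \<in> subpartition ?A \<sigma>"
      unfolding subpartition_def using B C(1) by blast
  qed
  have "{y \<in> ?A. y \<le> a} = {a}" "{y \<in> ?A. y \<le> b} = {a, b}"
    "{y \<in> ?A. y \<le> c} = {a, b, c}" "{y \<in> ?A. y \<le> d} = {a, b, c, d}"
    using less by auto
  then have ranks: "rank ?A a = 1" "rank ?A b = 2" "rank ?A c = 3" "rank ?A d = 4"
    unfolding rank_def using less by simp_all
  have A: "?A \<subseteq> \<Union>\<sigma>"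
    using B C mem by blast
  have "standardize (subpartition ?A \<sigma>) = (\<lambda>B. rank ?A ` B) ` subpartition ?A \<sigma>"
    unfolding standardize_def Union_subpartition[OF A] ..
  also have "\<dots> = {{1, 2, 4}, {3}}"
    unfolding sub by (simp only: image_insert image_empty ranks)
  finally show ?thesis using A
    unfolding contains_pattern_def by blast
qed

section \<open>Words of set partitions\<close>

text \<open>The definite description in \<open>rgf_of_partition\<close> is resolved here once and
  for all. Positions and list indices start at 0, elements and letters at 1, hence
  \<open>Suc i\<close> and \<open>j - 1\<close>.\<close>

lemma rgf_of_partition_nth_eq_iff:
  assumes part: "partition_on {1..n} \<sigma>" and "i < n"
  shows "rgf_of_partition n \<sigma> ! i = j \<longleftrightarrow>
    1 \<le> j \<and> j \<le> length (ordered_blocks \<sigma>) \<and> Suc i \<in> ordered_blocks \<sigma> ! (j - 1)"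
proof -
  let ?bs = "ordered_blocks \<sigma>"
  let ?P = "\<lambda>j. 1 \<le> j \<and> j \<le> length ?bs \<and> Suc i \<in> ?bs ! (j - 1)"
  note bs = ordered_blocks[OF part]
  have "Suc i \<in> \<Union>\<sigma>"
    using \<open>i < n\<close> partition_onD1[OF part] by auto
  then obtain k where "k < length ?bs" "Suc i \<in> ?bs ! k"
    using bs(1) by (metis UnionE in_set_conv_nth)
  then have ex: "?P (Suc k)" by simp
  \<comment> \<open>Disjointness makes the two blocks equal; equal blocks at different indices would
    contradict the strict increase of the minima.\<close>
  have "k = l" if "?P k" "?P l" for k l
  proof -
    have "?bs ! (k - 1) \<in> \<sigma>" "?bs ! (l - 1) \<in> \<sigma>"
      using that nth_mem[of "k - 1" ?bs] nth_mem[of "l - 1" ?bs] unfolding bs(1) by auto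
    then have eq: "?bs ! (k - 1) = ?bs ! (l - 1)"
      using that partition_onD2[OF part] by (auto simp: disjoint_def)
    have "\<not> k - 1 < l - 1" "\<not> l - 1 < k - 1"
      using sorted_wrt_nth_less[OF bs(2), of "k - 1" "l - 1"]
        sorted_wrt_nth_less[OF bs(2), of "l - 1" "k - 1"] eq that by fastforce+
    then have "k - 1 = l - 1" by simp
    with that show ?thesis by linarith
  qed
  with ex have ex1: "\<exists>!j. ?P j" by blast
  have "rgf_of_partition n \<sigma> ! i = (THE j. ?P j)"
    using \<open>i < n\<close> by (simp add: rgf_of_partition_def del: upt_Suc)
  then show ?thesis
    using theI'[OF ex1] the1_equality[OF ex1] by metis
qed

lemma length_rgf_of_partition [simp]: "length (rgf_of_partition n \<sigma>) = n"
  by (simp add: rgf_of_partition_def)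

text \<open>Pattern containment depends only on which letters coincide, so the actual letter values
  are eliminated.\<close>

lemma rgf_of_partition_nth_eq_nth_iff:
  assumes part: "partition_on {1..n} \<sigma>" and B: "B \<in> \<sigma>" "Suc i \<in> B" and "k < n"
  shows "rgf_of_partition n \<sigma> ! k = rgf_of_partition n \<sigma> ! i \<longleftrightarrow> Suc k \<in> B"
proof -
  let ?bs = "ordered_blocks \<sigma>"
  obtain j where j: "j < length ?bs" "?bs ! j = B"
    using B(1) ordered_blocks(1)[OF part] by (metis in_set_conv_nth)
  have "Suc i \<in> {1..n}"
    using B partition_onD1[OF part] by blast
  then have "i < n" by simp
  then have "rgf_of_partition n \<sigma> ! i = Suc j"
    using rgf_of_partition_nth_eq_iff[OF part] j B(2) by simp
  then show ?thesis
    using rgf_of_partition_nth_eq_iff[OF part \<open>k < n\<close>, of "Suc j"] j by simp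
qed

lemma contains_124_3_iff_rgf:
  assumes part: "partition_on {1..n} \<sigma>"
  defines "w \<equiv> rgf_of_partition n \<sigma>"
  shows "contains_pattern \<sigma> {{1, 2, 4}, {3}} \<longleftrightarrow>
    (\<exists>p q r s. p < q \<and> q < r \<and> r < s \<and> s < n \<and> w ! q = w ! p \<and> w ! s = w ! p \<and> w ! r \<noteq> w ! p)"
    (is "_ \<longleftrightarrow> ?R")
proof
  assume "contains_pattern \<sigma> {{1, 2, 4}, {3}}"
  then obtain B a b c d where B: "B \<in> \<sigma>" and less: "a < b" "b < c" "c < d"
    and mem: "a \<in> B" "b \<in> B" "d \<in> B" "c \<in> {1..n} - B"
    using contains_124_3_imp[OF part] by meson
  have "B \<subseteq> {1..n}" using B(1) partition_onD1[OF part] by blast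
  \<comment> \<open>The bound \<open>1 \<le> a\<close> keeps truncated subtraction of 1 strictly
    monotone on \<open>a\<close>, \<open>b\<close>, \<open>c\<close>, \<open>d\<close>.\<close>
  then have bounds: "1 \<le> a" "d \<le> n" using mem by auto
  have same: "w ! (x - 1) = w ! (a - 1) \<longleftrightarrow> x \<in> B" if "1 \<le> x" "x \<le> n" for x
    using rgf_of_partition_nth_eq_nth_iff[OF part B, of "a - 1" "x - 1"] that bounds mem
    by (simp add: w_def)
  have "a - 1 < b - 1" "b - 1 < c - 1" "c - 1 < d - 1" "d - 1 < n"
    using less bounds by linarith+
  moreover have "w ! (b - 1) = w ! (a - 1)" "w ! (d - 1) = w ! (a - 1)" "w ! (c - 1) \<noteq> w ! (a - 1)"
    using same[of b] same[of c] same[of d] less bounds mem by auto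
  ultimately show ?R by blast
next
  assume ?R
  then obtain p q r s where less: "p < q" "q < r" "r < s" "s < n"
    and eq: "w ! q = w ! p" "w ! s = w ! p" "w ! r \<noteq> w ! p" by blast
  obtain B where B: "B \<in> \<sigma>" "Suc p \<in> B"
  proof -
    have "Suc p \<in> \<Union>\<sigma>" using less partition_onD1[OF part] by auto
    then show ?thesis using that by blast
  qed
  note same = rgf_of_partition_nth_eq_nth_iff[OF part B, folded w_def]
  have "Suc q \<in> B" "Suc s \<in> B" "Suc r \<in> {1..n} - B"
    using same[of q] same[of s] same[of r] less eq by auto
  with less B show "contains_pattern \<sigma> {{1, 2, 4}, {3}}"
    by (intro contains_124_3I[OF part B(1), of "Suc p" "Suc q" "Suc r" "Suc s"]) auto
qed

section \<open>Words of set partitions satisfy the growth condition\<close>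

text \<open>The minimum of each block precedes all of the next block, so every letter other than 1
  has its predecessor somewhere before it. This yields the growth bound, and also the initial letter
  1, as nothing precedes position 0.\<close>

lemma restricted_growth_function_rgf_of_partition:
  assumes part: "partition_on {1..n} \<sigma>" and "1 \<le> n"
  shows "restricted_growth_function (rgf_of_partition n \<sigma>)"
proof -
  let ?bs = "ordered_blocks \<sigma>" and ?w = "rgf_of_partition n \<sigma>"
  note bs = ordered_blocks[OF part] and w = rgf_of_partition_nth_eq_iff[OF part]
  have pred: "\<exists>k<i. ?w ! k = ?w ! i - 1" if "i < n" "?w ! i \<noteq> 1" for i
  proof -
    define j where "j = ?w ! i"
    have j: "1 < j" "j \<le> length ?bs" "Suc i \<in> ?bs ! (j - 1)"
      using w[OF that(1), of j] that(2) by (auto simp: j_def)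
    have blk: "finite B \<and> B \<noteq> {} \<and> B \<subseteq> {1..n}" if "B \<in> \<sigma>" for B
      using that partition_onD1[OF part] partition_onD3[OF part]
      by (metis Union_upper finite_atLeastAtMost finite_subset)
    have "?bs ! (j - 1) \<in> \<sigma>" "?bs ! (j - 2) \<in> \<sigma>"
      using j nth_mem[of "j - 1" ?bs] nth_mem[of "j - 2" ?bs] unfolding bs(1) by auto
    note blks = blk[OF this(1)] blk[OF this(2)]
    \<comment> \<open>List index \<open>j - 2\<close> holds the block of letter
      \<open>j - 1\<close>, so position \<open>m - 1\<close> is the first occurrence of that
      letter.\<close>
    define m where "m = Min (?bs ! (j - 2))"
    have m: "m \<in> ?bs ! (j - 2)" "1 \<le> m"
    proof -
      show "m \<in> ?bs ! (j - 2)"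
        unfolding m_def using blks by simp
      then show "1 \<le> m" using blks by auto
    qed
    have "m < Min (?bs ! (j - 1))"
      unfolding m_def using sorted_wrt_nth_less[OF bs(2), of "j - 2" "j - 1"] j by simp
    also have "\<dots> \<le> Suc i" using blks j by simp
    finally have "m - 1 < i" using m by simp
    moreover have "?w ! (m - 1) = j - 1"
    proof -
      have "j - 1 - 1 = j - 2" "1 \<le> j - 1" "j - 1 \<le> length ?bs" using j by linarith+
      then show ?thesis
        using w[of "m - 1" "j - 1"] m \<open>m - 1 < i\<close> that(1) by simp
    qed
    ultimately show ?thesis unfolding j_def by blast
  qed
  have "?w ! i \<le> 1 + Max (set (take i ?w))" if i: "0 < i" "i < n" for i
  proof (cases "?w ! i = 1")
    case False
    then obtain k where k: "k < i" "?w ! k = ?w ! i - 1" using pred i by blast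
    then have "?w ! i - 1 \<in> set (take i ?w)"
      using i by (auto simp: in_set_conv_nth intro!: exI[of _ k])
    then have "?w ! i - 1 \<le> Max (set (take i ?w))" by simp
    then show ?thesis by simp
  qed simp
  moreover have "0 < a" if a: "a \<in> set ?w" for a
  proof -
    obtain i where "i < n" "?w ! i = a"
      using a by (auto simp: in_set_conv_nth)
    then show ?thesis using w[of i a] by simp
  qed
  moreover have "?w ! 0 = 1"
    using pred[of 0] \<open>1 \<le> n\<close> by auto
  moreover have "?w \<noteq> []"
    using \<open>1 \<le> n\<close> by (metis length_rgf_of_partition list.size(3) not_one_le_zero)
  ultimately show ?thesis
    unfolding restricted_growth_function_def by simp
qed

section \<open>Every restricted growth function is the word of a set partition\<close>

text \<open>By induction on the prefix: the next letter either repeats one of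
  \<open>1, ..., M\<close> or is the new maximum \<open>M + 1\<close>, so no value is
  skipped.\<close>

lemma set_take_restricted_growth_function:
  assumes "restricted_growth_function w" "0 < i" "i \<le> length w"
  shows "set (take i w) = {1..Max (set (take i w))}"
  using assms(2,3)
proof (induction i)
  case (Suc i)
  have take: "set (take (Suc i) w) = insert (w ! i) (set (take i w))"
    using Suc.prems by (simp add: take_Suc_conv_app_nth)
  show ?case
  proof (cases "i = 0")
    case True
    then show ?thesis
      using take assms(1) by (simp add: restricted_growth_function_def)
  next
    case False
    define M where "M = Max (set (take i w))"
    have IH: "set (take i w) = {1..M}"
      using Suc False unfolding M_def by simp
    have "w ! i \<le> 1 + M" "0 < w ! i"
      using assms(1) Suc.prems False unfolding restricted_growth_function_def M_def by auto
    then have "w ! i = Suc M \<or> w ! i \<in> {1..M}" by auto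
    then show ?thesis
    proof
      assume "w ! i = Suc M"
      then have "set (take (Suc i) w) = {1..Suc M}"
        unfolding take IH by auto
      moreover have "Max {1..Suc M} = Suc M" by (rule Max_eqI) auto
      ultimately show ?thesis by simp
    next
      assume "w ! i \<in> {1..M}"
      then have "set (take (Suc i) w) = {1..M}" "1 \<le> M"
        unfolding take IH by auto
      moreover have "Max {1..M} = M" using \<open>1 \<le> M\<close> by (intro Max_eqI) auto
      ultimately show ?thesis by simp
    qed
  qed
qed simp

text \<open>The earlier letters fill \<open>{1..M}\<close> and \<open>w ! i \<le> 1 + M\<close>.
  Consequently the first occurrences of the letters appear in increasing order of the
  letters.\<close>

lemma restricted_growth_function_smaller_before:
  assumes rgf: "restricted_growth_function w" and i: "i < length w" and a: "0 < a" "a < w ! i"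
  shows "a \<in> set (take i w)"
proof (rule ccontr)
  assume notin: "a \<notin> set (take i w)"
  have "i \<noteq> 0"
    using rgf a unfolding restricted_growth_function_def by (metis less_one not_less0)
  then have set: "set (take i w) = {1..Max (set (take i w))}" and le: "w ! i \<le> 1 + Max (set (take i w))"
    using set_take_restricted_growth_function[OF rgf, of i] rgf i
    unfolding restricted_growth_function_def by auto
  have "a \<in> {1..Max (set (take i w))}" using a le by auto
  with notin equalityD2[OF set] show False by blast
qed

text \<open>The blocks are the occurrence sets of the letters, shifted by one. What needs proof is
  that ordering them by minima lists them in the order of their letters.\<close>

lemma ex_partition_rgf_eq:
  assumes rgf: "restricted_growth_function w"
  shows "\<exists>\<sigma>. partition_on {1..length w} \<sigma> \<and> rgf_of_partition (length w) \<sigma> = w"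
proof -
  define n where "n = length w"
  define m where "m = Max (set w)"
  define blk where "blk a = Suc ` occurrences w a" for a
  define \<sigma> where "\<sigma> = blk ` set w"
  have "w \<noteq> []" using rgf unfolding restricted_growth_function_def by blast
  then have set_w: "set w = {1..m}"
    using set_take_restricted_growth_function[OF rgf, of "length w"] by (simp add: m_def)
  have in_blk: "Suc i \<in> blk a \<longleftrightarrow> i < n \<and> w ! i = a" for i a
    by (auto simp: blk_def occurrences_def n_def)
  have blk_sub: "blk a \<subseteq> {1..n}" for a
    by (auto simp: blk_def occurrences_def n_def)
  then have fin: "finite (blk a)" for a using finite_subset by blast
  have ne: "blk a \<noteq> {}" if "a \<in> set w" for a
    using that by (auto simp: blk_def occurrences_def in_set_conv_nth)
  have disj: "a = b" if "x \<in> blk a" "x \<in> blk b" for a b x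
    using that by (auto simp: blk_def occurrences_def)
  have part: "partition_on {1..n} \<sigma>"
  proof (rule partition_onI)
    show "\<Union>\<sigma> = {1..n}"
    proof
      show "{1..n} \<subseteq> \<Union>\<sigma>"
      proof
        fix x assume "x \<in> {1..n}"
        then have "x - 1 < n" "Suc (x - 1) = x" by auto
        then have "x \<in> blk (w ! (x - 1))" "w ! (x - 1) \<in> set w"
          using in_blk[of "x - 1"] by (simp_all add: n_def)
        then show "x \<in> \<Union>\<sigma>" unfolding \<sigma>_def by blast
      qed
    qed (use blk_sub in \<open>auto simp: \<sigma>_def\<close>)
    show "disjnt p q" if "p \<in> \<sigma>" "q \<in> \<sigma>" "p \<noteq> q" for p q
      using that disj unfolding \<sigma>_def disjnt_def by blast
    show "{} \<notin> \<sigma>" using ne unfolding \<sigma>_def by blast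
  qed
  \<comment> \<open>The letter \<open>a\<close> already occurs before the first occurrence of the
    larger letter \<open>b\<close>.\<close>
  have Min_less: "Min (blk a) < Min (blk b)" if "a \<in> set w" "b \<in> set w" "a < b" for a b
  proof -
    have "Min (blk b) \<in> blk b" using fin ne that by simp
    then obtain i where i: "Min (blk b) = Suc i" "i < n" "w ! i = b"
      by (auto simp: blk_def occurrences_def n_def)
    have "0 < a" using that set_w by simp
    then have "a \<in> set (take i w)"
      using restricted_growth_function_smaller_before[OF rgf] i that by (simp add: n_def)
    then obtain k where "k < i" "w ! k = a" by (auto simp: in_set_conv_nth)
    then have "Suc k \<in> blk a" using in_blk i(2) by simp
    then have "Min (blk a) \<le> Suc k" using fin by simp
    with \<open>k < i\<close> i(1) show ?thesis by simp
  qed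
  \<comment> \<open>Both lists have the same elements and strictly increasing minima. As
    \<open>Min\<close> is injective on the blocks, this determines the list.\<close>
  have "ordered_blocks \<sigma> = map blk [1..<Suc m]"
  proof (rule map_sorted_distinct_set_unique[of Min])
    have set_map: "set (map blk [1..<Suc m]) = \<sigma>"
      unfolding \<sigma>_def set_w by auto
    have sw: "sorted_wrt (\<lambda>B C. Min B < Min C) (map blk [1..<Suc m])"
      unfolding sorted_wrt_map
      by (rule sorted_wrt_mono_rel[OF _ sorted_wrt_upt])
        (use Min_less set_w in auto)
    show "set (ordered_blocks \<sigma>) = set (map blk [1..<Suc m])"
      using set_map ordered_blocks(1)[OF part] by simp
    have "inj_on Min \<sigma>"
      unfolding \<sigma>_def
    proof (rule inj_onI, elim imageE)
      fix x y a b assume "Min x = Min y" and xy: "x = blk a" "a \<in> set w" "y = blk b" "b \<in> set w"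
      then have "\<not> a < b" "\<not> b < a" using Min_less[of a b] Min_less[of b a] by auto
      with xy show "x = y" by simp
    qed
    then show "inj_on Min (set (ordered_blocks \<sigma>) \<union> set (map blk [1..<Suc m]))"
      unfolding set_map ordered_blocks(1)[OF part] by simp
    show "sorted (map Min (ordered_blocks \<sigma>))" "distinct (map Min (ordered_blocks \<sigma>))"
      using ordered_blocks(2)[OF part]
      unfolding sorted_wrt_map[of "(<)" Min, symmetric] strict_sorted_iff by auto
    show "sorted (map Min (map blk [1..<Suc m]))" "distinct (map Min (map blk [1..<Suc m]))"
      using sw unfolding sorted_wrt_map[of "(<)" Min, symmetric] strict_sorted_iff by blast+
  qed
  then have "rgf_of_partition n \<sigma> ! i = w ! i" if "i < n" for i
  proof -
    have "w ! i \<in> {1..m}" using set_w that by (metis n_def nth_mem)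
    then have "w ! i - 1 < m" "1 + (w ! i - 1) = w ! i" by auto
    then have "map blk [1..<Suc m] ! (w ! i - 1) = blk (w ! i)"
      by (simp del: upt_Suc)
    with that \<open>w ! i \<in> {1..m}\<close> show ?thesis
      unfolding rgf_of_partition_nth_eq_iff[OF part that] \<open>ordered_blocks \<sigma> = _\<close>
      by (simp add: in_blk del: upt_Suc)
  qed
  then have "rgf_of_partition n \<sigma> = w"
    by (intro nth_equalityI) (simp_all add: n_def)
  with part show ?thesis unfolding n_def by blast
qed

section \<open>Block letters and singleton-block letters\<close>

text \<open>States maximality of a run through the occurrence set alone:
  \<open>j \<notin> occurrences w a\<close> covers both the end of the word and a different letter
  at \<open>j\<close>.\<close>

lemma is_blockI:
  assumes "{i..<j} \<subseteq> occurrences w a" "i < j" "i = 0 \<or> i - 1 \<notin> occurrences w a" "j \<notin> occurrences w a"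
  shows "is_block w a i j"
proof -
  have in_occ: "k < length w \<and> w ! k = a" if "k \<in> {i..<j}" for k
    using assms(1) that by (auto simp: occurrences_def)
  have "j - 1 < length w" "i < length w"
    using in_occ[of "j - 1"] in_occ[of i] assms(2) by auto
  moreover from this have "i = 0 \<or> w ! (i - 1) \<noteq> a" "j = length w \<or> w ! j \<noteq> a"
    using assms(2-4) by (auto simp: occurrences_def)
  moreover have "j \<le> length w" using \<open>j - 1 < length w\<close> by simp
  ultimately show ?thesis
    unfolding is_block_def using in_occ assms(2) by auto
qed

text \<open>The forbidden positions exist exactly when the occurrences of \<open>a\<close> after the
  first one have a gap: \<open>p\<close> may be taken as the first occurrence, and \<open>r\<close>
  lies in a gap between \<open>q\<close> and \<open>s\<close>.\<close>

lemma block_or_singleton_block_letter_iff: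
  assumes "a \<in> set w"
  shows "block_letter w a \<or> singleton_block_letter w a \<longleftrightarrow>
    \<not> (\<exists>p q r s. p < q \<and> q < r \<and> r < s \<and> s < length w \<and>
        w ! p = a \<and> w ! q = a \<and> w ! s = a \<and> w ! r \<noteq> a)"
    (is "_ \<longleftrightarrow> \<not> ?P")
proof
  let ?O = "occurrences w a"
  assume bs: "block_letter w a \<or> singleton_block_letter w a"
  show "\<not> ?P"
  proof
    assume ?P
    then obtain p q r s where less: "p < q" "q < r" "r < s"
      and O: "p \<in> ?O" "q \<in> ?O" "s \<in> ?O" "r \<notin> ?O"
      unfolding occurrences_def by auto
    from bs show False
    proof
      assume "block_letter w a"
      then obtain i j where "?O = {i..<j}" unfolding block_letter_def by blast
      with O less show False by auto
    next
      assume "singleton_block_letter w a"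
      then obtain p0 i j where "\<forall>x\<in>?O. p0 \<le> x" and eq: "?O - {p0} = {i..<j}"
        unfolding singleton_block_letter_def by blast
      \<comment> \<open>Since \<open>p0 \<le> p < q < s\<close>, removing \<open>p0\<close> keeps
        \<open>q\<close> and \<open>s\<close>, while the interval would have to contain
        \<open>r\<close> as well.\<close>
      then have "p0 \<le> p" using O by blast
      then have "q \<in> {i..<j}" "s \<in> {i..<j}" "r \<notin> {i..<j}"
        unfolding eq[symmetric] using O less by auto
      with less show False by auto
    qed
  qed
next
  let ?O = "occurrences w a"
  assume avoid: "\<not> ?P"
  have fin: "finite ?O" unfolding occurrences_def by simp
  have "?O \<noteq> {}" using assms by (auto simp: occurrences_def in_set_conv_nth)
  define p where "p = Min ?O"
  have p: "p \<in> ?O" "\<And>x. x \<in> ?O \<Longrightarrow> p \<le> x"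
    unfolding p_def using fin \<open>?O \<noteq> {}\<close> by auto
  have block: "block_letter w a" if "?O = {i..<j}" "i < j" for i j
    unfolding block_letter_def
    by (intro exI[of _ i] exI[of _ j] conjI is_blockI) (use that in auto)
  show "block_letter w a \<or> singleton_block_letter w a"
  proof (cases "?O = {p}")
    case True
    then show ?thesis using block[of p "Suc p"] by auto
  next
    case False
    then have ne: "?O - {p} \<noteq> {}" using p(1) by blast
    define i where "i = Min (?O - {p})"
    define l where "l = Max (?O - {p})"
    have i: "i \<in> ?O - {p}" "\<And>x. x \<in> ?O - {p} \<Longrightarrow> i \<le> x"
      and l: "l \<in> ?O - {p}" "\<And>x. x \<in> ?O - {p} \<Longrightarrow> x \<le> l"
      unfolding i_def l_def using fin ne Min_in[of "?O - {p}"] Max_in[of "?O - {p}"] by auto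
    have "p < i" using p i by (metis DiffD1 DiffD2 insertI1 le_neq_implies_less)
    \<comment> \<open>A missing position \<open>x\<close> would make \<open>p\<close>,
      \<open>i\<close>, \<open>x\<close>, \<open>l\<close> a forbidden quadruple.\<close>
    have mid: "x \<in> ?O" if "i \<le> x" "x \<le> l" for x
    proof (rule ccontr)
      assume "x \<notin> ?O"
      then have "x \<noteq> i" "x \<noteq> l" using i l by auto
      then have "p < i \<and> i < x \<and> x < l" using that \<open>p < i\<close> by simp
      moreover have "l < length w \<and> w ! p = a \<and> w ! i = a \<and> w ! l = a"
        using p(1) i(1) l(1) by (auto simp: occurrences_def)
      moreover have "w ! x \<noteq> a"
        using \<open>x \<notin> ?O\<close> calculation by (auto simp: occurrences_def)
      ultimately show False using avoid by blast
    qed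
    have eq: "?O - {p} = {i..<Suc l}"
    proof (intro equalityI subsetI)
      show "x \<in> {i..<Suc l}" if "x \<in> ?O - {p}" for x
        using i(2)[OF that] l(2)[OF that] by simp
      show "x \<in> ?O - {p}" if "x \<in> {i..<Suc l}" for x
        using mid[of x] that \<open>p < i\<close> by simp
    qed
    have "i \<le> l" using i(2) l(1) by blast
    show ?thesis
    \<comment> \<open>If the second occurrence directly follows the first, \<open>p\<close> joins
      the interval into one block; otherwise a different letter follows \<open>p\<close>, and the
      interval is a separate block.\<close>
    proof (cases "i = Suc p")
      case True
      have "?O = insert p (?O - {p})" using p(1) by blast
      also have "\<dots> = {p..<Suc l}" unfolding eq using True \<open>i \<le> l\<close> by auto
      finally show ?thesis using block[of p "Suc l"] \<open>p < i\<close> \<open>i \<le> l\<close> by auto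
    next
      case False
      have gap: "x \<notin> ?O" if "x \<noteq> p" "x \<notin> {i..<Suc l}" for x
        using that unfolding eq[symmetric] by blast
      have "is_block w a i (Suc l)"
        by (rule is_blockI) (use eq \<open>p < i\<close> \<open>i \<le> l\<close> False gap[of "i - 1"] gap[of "Suc l"] in auto)
      moreover have "Suc p < length w"
        using \<open>p < i\<close> i(1) by (auto simp: occurrences_def)
      moreover have "w ! Suc p \<noteq> a"
        using gap[of "Suc p"] \<open>p < i\<close> False calculation by (auto simp: occurrences_def)
      ultimately have "singleton_block_letter w a"
        unfolding singleton_block_letter_def using p \<open>p < i\<close> eq by blast
      then show ?thesis ..
    qed
  qed
qed

text \<open>The letter is absorbed as \<open>w ! p\<close>. The right side then has the shape of the
  containment criterion for words, so avoidance and the letter condition become the same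
  statement.\<close>

lemma all_block_or_singleton_block_letter_iff:
  "(\<forall>a\<in>set w. block_letter w a \<or> singleton_block_letter w a) \<longleftrightarrow>
    \<not> (\<exists>p q r s. p < q \<and> q < r \<and> r < s \<and> s < length w \<and>
        w ! q = w ! p \<and> w ! s = w ! p \<and> w ! r \<noteq> w ! p)"
  (is "?L \<longleftrightarrow> \<not> (\<exists>p q r s. ?P p q r s)")
proof -
  have "?L \<longleftrightarrow> (\<forall>a\<in>set w. \<not> (\<exists>p q r s. ?P p q r s \<and> w ! p = a))"
  proof (intro ball_cong refl)
    fix a assume "a \<in> set w"
    then show "block_letter w a \<or> singleton_block_letter w a \<longleftrightarrow>
        \<not> (\<exists>p q r s. ?P p q r s \<and> w ! p = a)"
      unfolding block_or_singleton_block_letter_iff[OF \<open>a \<in> set w\<close>]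
      by (intro arg_cong[where f = Not] ex_cong1) auto
  qed
  also have "\<dots> \<longleftrightarrow> \<not> (\<exists>p q r s. ?P p q r s)"
  proof
    assume *: "\<forall>a\<in>set w. \<not> (\<exists>p q r s. ?P p q r s \<and> w ! p = a)"
    show "\<not> (\<exists>p q r s. ?P p q r s)"
    proof
      assume "\<exists>p q r s. ?P p q r s"
      then obtain p q r s where P: "?P p q r s" by blast
      then have "w ! p \<in> set w" by simp
      with * P show False by blast
    qed
  qed blast
  finally show ?thesis .
qed

theorem theorem3p8:
  fixes n :: nat
  assumes "n \<ge> 1"
  shows "R n {{1, 2, 4}, {3}} =
    {w. restricted_growth_function w \<and> length w = n \<and>
        (\<forall>a \<in> set w. block_letter w a \<or> singleton_block_letter w a)}"
proof (intro equalityI subsetI)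
  fix w assume "w \<in> R n {{1, 2, 4}, {3}}"
  then obtain \<sigma> where \<sigma>: "rgf_of_partition n \<sigma> = w" "partition_on {1..n} \<sigma>"
    "\<not> contains_pattern \<sigma> {{1, 2, 4}, {3}}"
    unfolding R_def avoiding_partitions_def by blast
  have len: "length w = n"
    using \<sigma>(1) length_rgf_of_partition by blast
  moreover have "restricted_growth_function w"
    using restricted_growth_function_rgf_of_partition[OF \<sigma>(2) assms] \<sigma>(1) by simp
  moreover have "\<forall>a \<in> set w. block_letter w a \<or> singleton_block_letter w a"
    using \<sigma>(3) unfolding all_block_or_singleton_block_letter_iff
      contains_124_3_iff_rgf[OF \<sigma>(2)] \<sigma>(1) len .
  ultimately show "w \<in> {w. restricted_growth_function w \<and> length w = n \<and>
        (\<forall>a \<in> set w. block_letter w a \<or> singleton_block_letter w a)}"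
    by blast
next
  fix w assume "w \<in> {w. restricted_growth_function w \<and> length w = n \<and>
        (\<forall>a \<in> set w. block_letter w a \<or> singleton_block_letter w a)}"
  then have w: "restricted_growth_function w" "length w = n"
      "\<forall>a \<in> set w. block_letter w a \<or> singleton_block_letter w a" by auto
  \<comment> \<open>Any partition with word \<open>w\<close> will do, because avoidance can be read
    off the word.\<close>
  obtain \<sigma> where \<sigma>: "partition_on {1..n} \<sigma>" "rgf_of_partition n \<sigma> = w"
    using ex_partition_rgf_eq[OF w(1)] w(2) by blast
  have "\<not> contains_pattern \<sigma> {{1, 2, 4}, {3}}"
    using w(3) unfolding all_block_or_singleton_block_letter_iff contains_124_3_iff_rgf[OF \<sigma>(1)] \<sigma>(2) w(2) .
  with \<sigma> show "w \<in> R n {{1, 2, 4}, {3}}"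
    unfolding R_def avoiding_partitions_def by blast
qed

end
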